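(* Let $m$ be a positive integer and $s=2m$. Then for every integer $N\ge 2$, $$\mathcal{L}_s(N)=\sum_{n=0}^{m}\alpha_n(s)\,\frac{2\zeta(s-2n)}{(2\pi)^s}\,N^{1+s-2n}.$$
   Context: For $s\in\mathbb{C}$, $s\ne0$, and integers $N\ge 2$, $$\mathcal{L}_s(N)=2^{-s}N\sum_{k=1}^{N-1}\Big(\sin\frac{\pi k}{N}\Big)^{-s}.$$ $\zeta$ is the (analytically continued) Riemann zeta function (so $\zeta(0)=-1/2$). The coefficients $\alpha_n(s)$, $n\ge0$, are defined by $$\Big(\frac{\sin\pi z}{\pi z}\Big)^{-s}=\sum_{n=0}^\infty\alpha_n(s)\,z^{2n},\qquad |z|<1.$$ *)

theory Defs
  imports "HOL-Complex_Analysis.Complex_Analysis"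
begin

definition riesz_sum :: "complex \<Rightarrow> nat \<Rightarrow> complex" where
  "riesz_sum s N = 2 powr (- s) * of_nat N *
     (\<Sum>k = 1..N - 1. complex_of_real (sin (pi * real k / real N)) powr (- s))"

(* The analytic continuation to the punctured plane is unique; the value at the pole
   s = 1 carries no meaning and is fixed to be 0 only to make the description definite. *)
definition riemann_zeta :: "complex \<Rightarrow> complex" where
  "riemann_zeta = (THE f. f holomorphic_on (- {1}) \<and>
     (\<forall>s. Re s > 1 \<longrightarrow> (\<lambda>n. 1 / of_nat (Suc n) powr s) sums f s) \<and>
     f 1 = 0)"

definition sinc_pi :: "complex \<Rightarrow> complex" where
  "sinc_pi z = (if z = 0 then 1 else sin (of_real pi * z) / (of_real pi * z))"

(* On the open unit disc sinc_pi takes no value in the closed negative real axis: in the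
   product of the factors 1 - z^2 / k^2 the arguments add up to less than
   pi / 2 + (sum over k >= 2 of arcsin (1 / k^2)) < pi.  The principal branch used by powr
   is therefore the holomorphic branch with value 1 at z = 0. *)
definition sinc_coeff :: "nat \<Rightarrow> complex \<Rightarrow> complex" where
  "sinc_coeff n s = (THE a. \<forall>z. norm z < 1 \<longrightarrow>
     (\<lambda>j. a j * z ^ (2 * j)) sums (sinc_pi z powr (- s))) n"

end

theory Submission
  imports Defs
begin

text \<open>
  Proof idea. The function $(\pi / \sin \pi z)^{2m}$ has principal part
  $\sum_{n<m} \alpha_n z^{-(2m-2n)}$ and constant term $\alpha_m$ at $0$. Subtracting
  $\sum_{n<m} \alpha_n \sum_{j \in Z} (z+j)^{-(2m-2n)}$ leaves a $1$-periodic entire function that is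
  bounded on a period strip and vanishes at $i\infty$, hence is zero by Liouville. Summing the
  resulting partial fraction expansion over $z = k/N$ turns each lattice sum into
  $2\zeta(2m-2n)(N^{2m-2n} - 1)$, because the numbers $k + Nj$ run through the integers not
  divisible by $N$; comparing constant terms at $0$ gives
  $\alpha_m = \sum_{n<m} \alpha_n 2\zeta(2m-2n)$. Thus the contributions of $-1$ add up to
  $-\alpha_m = 2\zeta(0)\alpha_m$, which is the term $n = m$.

  The zeta function is continued strip by strip: expanding $(1+1/n)^{1-s}$ in the telescoping sum of
  $(n+1)^{1-s} - n^{1-s}$ expresses $(s-1)\zeta(s)$ through the values $(s+k-2)\zeta(s+k-1)$
  with $k \ge 2$ and a series of Taylor remainders that converges further to the left.
\<close>

section \<open>Analytic continuation of the zeta function\<close>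

text \<open>Induction on \<open>K\<close>: the derivative in \<open>x\<close> of the remainder with
  \<open>Suc K\<close> terms and exponent \<open>w\<close> is \<open>w\<close> times the remainder
  with \<open>K\<close> terms and exponent \<open>w - 1\<close>. Lowering the exponent may raise its
  norm by 1, so \<open>B\<close> varies in the induction. Uniformity in \<open>w\<close> is what the
  M-test for \<open>zeta_rem\<close> rests on.\<close>

lemma powr_taylor_remainder_bound:
  "\<exists>C\<ge>0. \<forall>w x. norm (w::complex) \<le> B \<longrightarrow> 0 \<le> x \<longrightarrow> x \<le> 1 \<longrightarrow>
     norm ((1 + of_real x) powr w - (\<Sum>k<K. (w gchoose k) * of_real x ^ k)) \<le> C * x ^ K"
proof (induction K arbitrary: B)
  case 0
  have "norm ((1 + of_real x) powr w) \<le> 2 powr \<bar>B\<bar>" if "norm w \<le> B" "0 \<le> x" "x \<le> 1" for w :: complex and x :: real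
  proof -
    have "norm ((1 + of_real x) powr w) = (1 + x) powr Re w"
      using that by (subst norm_powr_real_powr) auto
    also have "\<dots> \<le> (1 + x) powr \<bar>B\<bar>"
      using that complex_Re_le_cmod[of w] by (intro powr_mono) auto
    also have "\<dots> \<le> 2 powr \<bar>B\<bar>"
      using that by (intro powr_mono2) auto
    finally show ?thesis .
  qed
  thus ?case by (intro exI[of _ "2 powr \<bar>B\<bar>"]) auto
next
  case (Suc K)
  obtain C where C: "C \<ge> 0" "\<And>w x. norm (w::complex) \<le> B + 1 \<Longrightarrow> 0 \<le> x \<Longrightarrow> x \<le> 1 \<Longrightarrow>
     norm ((1 + of_real x) powr w - (\<Sum>k<K. (w gchoose k) * of_real x ^ k)) \<le> C * x ^ K"
    using Suc.IH[of "B + 1"] by blast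
  have "norm ((1 + of_real x) powr w - (\<Sum>k<Suc K. (w gchoose k) * of_real x ^ k)) \<le> (\<bar>B\<bar> * C) * x ^ Suc K"
    if w: "norm w \<le> B" and x: "0 \<le> x" "x \<le> 1" for w :: complex and x :: real
  proof -
    define f where "f = (\<lambda>z::complex. (1 + z) powr w - (\<Sum>k<Suc K. (w gchoose k) * z ^ k))"
    define f' where "f' = (\<lambda>z::complex. w * ((1 + z) powr (w - 1) - (\<Sum>k<K. ((w - 1) gchoose k) * z ^ k)))"
    \<comment> \<open>Mean value estimate on the segment from 0 to \<open>x\<close>; the length of
      the segment supplies the additional factor \<open>x\<close>.\<close>
    have "norm (f (of_real x) - f 0) \<le> (\<bar>B\<bar> * C * x ^ K) * norm (of_real x - (0::complex))"
    proof (rule field_differentiable_bound[where S = "closed_segment 0 (of_real x)"])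
      fix z :: complex assume "z \<in> closed_segment 0 (of_real x)"
      then obtain u where u: "0 \<le> u" "u \<le> 1" "z = of_real (u * x)"
        by (auto simp: in_segment scaleR_conv_of_real)
      define t where "t = u * x"
      have t: "z = of_real t" "0 \<le> t" "t \<le> x"
        using u x by (auto simp: t_def mult_left_le_one_le)
      have "1 + z \<notin> \<real>\<^sub>\<le>\<^sub>0"
        using t by (auto simp: complex_nonpos_Reals_iff)
      moreover have "(\<Sum>k<Suc K. of_nat k * z ^ (k - Suc 0) * (w gchoose k)) =
              w * (\<Sum>k<K. ((w - 1) gchoose k) * z ^ k)"
        unfolding sum.lessThan_Suc_shift sum_distrib_left
      proof -
        have "of_nat (Suc k) * z ^ (Suc k - Suc 0) * (w gchoose Suc k) = w * ((w - 1 gchoose k) * z ^ k)" for k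
        proof -
          have "of_nat (Suc k) * z ^ (Suc k - Suc 0) * (w gchoose Suc k) = (of_nat (Suc k) * (w gchoose Suc k)) * z ^ k"
            by (simp only: diff_Suc_Suc diff_zero mult_ac)
          thus ?thesis by (simp only: gbinomial_absorption mult_ac)
        qed
        thus "of_nat 0 * z ^ (0 - Suc 0) * (w gchoose 0) +
          (\<Sum>k<K. of_nat (Suc k) * z ^ (Suc k - Suc 0) * (w gchoose Suc k)) =
          (\<Sum>k<K. w * ((w - 1 gchoose k) * z ^ k))"
          by (simp only: of_nat_0 mult_zero_left add_0_left)
      qed
      ultimately show "(f has_field_derivative f' z) (at z within closed_segment 0 (of_real x))"
        unfolding f_def f'_def right_diff_distrib
        by (intro DERIV_diff) (auto intro!: derivative_eq_intros simp del: sum.lessThan_Suc)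
      have "norm (w - 1) \<le> B + 1"
        using norm_triangle_ineq4[of w 1] w by simp
      hence "norm (f' z) \<le> norm w * (C * t ^ K)"
        unfolding f'_def norm_mult t(1) using C(2)[of "w - 1" t] t x by (intro mult_left_mono) auto
      also have "\<dots> \<le> \<bar>B\<bar> * (C * x ^ K)"
        using w t C(1) by (intro mult_mono power_mono) auto
      finally show "norm (f' z) \<le> \<bar>B\<bar> * C * x ^ K" by (simp add: mult.assoc)
    qed auto
    moreover have "f 0 = 0" unfolding f_def sum.lessThan_Suc_shift by simp
    ultimately show ?thesis using x by (simp add: f_def mult_ac del: sum.lessThan_Suc)
  qed
  thus ?case using C(1) by (intro exI[of _ "\<bar>B\<bar> * C"]) auto
qed

text \<open>Error of expanding the power of n + 2 with exponent 1 - s about n + 1 up to degree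
  \<open>K\<close>, hence with \<open>Suc K\<close> terms.\<close>

definition zeta_rem :: "nat \<Rightarrow> complex \<Rightarrow> nat \<Rightarrow> complex" where
  "zeta_rem K s n = of_nat (Suc n) powr (1 - s) *
     ((1 + of_real (1 / real (Suc n))) powr (1 - s) -
      (\<Sum>k<Suc K. ((1 - s) gchoose k) * of_real (1 / real (Suc n)) ^ k))"

text \<open>The exponent 1 - Re s of the prefactor and - (K + 1) from the Taylor bound add up to -
  (Re s + K). With c > 1 the majorant is a convergent series independent of
  \<open>s\<close>.\<close>

lemma zeta_rem_bound:
  assumes "c > 1"
  shows "\<exists>M. summable M \<and> (\<forall>s n. norm s \<le> B \<longrightarrow> Re s + real K \<ge> c \<longrightarrow> norm (zeta_rem K s n) \<le> M n)"
proof -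
  obtain C where C: "C \<ge> 0" "\<And>w x. norm (w::complex) \<le> B + 1 \<Longrightarrow> 0 \<le> x \<Longrightarrow> x \<le> 1 \<Longrightarrow>
     norm ((1 + of_real x) powr w - (\<Sum>k<Suc K. (w gchoose k) * of_real x ^ k)) \<le> C * x ^ Suc K"
    using powr_taylor_remainder_bound[of "B + 1" "Suc K"] by blast
  define M where "M = (\<lambda>n. C * real (Suc n) powr (-c))"
  have "summable M"
    unfolding M_def using assms
    by (intro summable_mult, subst summable_Suc_iff) (simp add: summable_real_powr_iff)
  moreover have "norm (zeta_rem K s n) \<le> M n" if s: "norm s \<le> B" "Re s + real K \<ge> c" for s n
  proof -
    have "norm (1 - s) \<le> B + 1"
      using norm_triangle_ineq4[of 1 s] s by simp
    hence "norm (zeta_rem K s n) \<le> real (Suc n) powr (1 - Re s) * (C * (1 / real (Suc n)) ^ Suc K)"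
      unfolding zeta_rem_def norm_mult
      using C(2)[of "1 - s" "1 / real (Suc n)"]
      by (intro mult_mono) (auto simp: norm_powr_real_powr simp del: of_nat_Suc)
    also have "(1 / real (Suc n)) ^ Suc K = real (Suc n) powr (- real (Suc K))"
      by (subst powr_minus, subst powr_realpow) (auto simp: power_divide divide_inverse power_inverse simp del: of_nat_Suc power_Suc)
    also have "real (Suc n) powr (1 - Re s) * (C * real (Suc n) powr (- real (Suc K))) =
        C * real (Suc n) powr (- (Re s + real K))"
      by (simp add: powr_add[symmetric] del: of_nat_Suc) (simp add: algebra_simps)
    also have "\<dots> \<le> M n"
      unfolding M_def using s C(1) by (intro mult_left_mono powr_mono) auto
    finally show ?thesis .
  qed
  ultimately show ?thesis by blast
qed

lemma holomorphic_zeta_rem [holomorphic_intros]: "(\<lambda>s. zeta_rem K s n) holomorphic_on A"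
proof -
  have "(\<lambda>s::complex. (1 - s) gchoose k) holomorphic_on A" for k
    unfolding gbinomial_prod_rev by (intro holomorphic_intros) auto
  moreover have "1 + of_real (1 / real (Suc n)) \<noteq> (0::complex)"
    by (metis (no_types) of_real_1 of_real_add of_real_eq_0_iff add_pos_pos less_irrefl divide_pos_pos of_nat_0_less_iff zero_less_Suc zero_less_one)
  ultimately show ?thesis
    unfolding zeta_rem_def by (intro holomorphic_intros) (auto simp del: of_nat_Suc)
qed

lemma holomorphic_suminf_zeta_rem:
  "(\<lambda>s. \<Sum>n. zeta_rem K s n) holomorphic_on {s. Re s > 1 - real K}"
proof (rule holomorphic_uniform_sequence[where f = "\<lambda>N s. \<Sum>n<N. zeta_rem K s n"])
  show "open {s. Re s > 1 - real K}" by (rule open_halfspace_Re_gt)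
  fix x assume "x \<in> {s. Re s > 1 - real K}"
  hence x: "Re x + real K > 1" by simp
  \<comment> \<open>Half the distance from \<open>x\<close> to the boundary line Re s = 1 - K, so
    that Re s + K >= 1 + d on the closed disc.\<close>
  define d where "d = (Re x + real K - 1) / 2"
  have d: "d > 0" using x by (simp add: d_def)
  have ge: "Re y + real K \<ge> 1 + d" if "y \<in> cball x d" for y
  proof -
    have "\<bar>Re x - Re y\<bar> \<le> d"
      using that abs_Re_le_cmod[of "x - y"] by (simp add: dist_norm)
    thus ?thesis by (simp add: d_def field_simps abs_if split: if_splits)
  qed
  obtain M where M: "summable M" "\<And>s n. norm s \<le> norm x + d \<Longrightarrow> Re s + real K \<ge> 1 + d \<Longrightarrow> norm (zeta_rem K s n) \<le> M n"
    using zeta_rem_bound[of "1 + d" "norm x + d" K] d by auto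
  have nle: "norm y \<le> norm x + d" if "y \<in> cball x d" for y
    using that norm_triangle_ineq2[of y x] by (simp add: dist_norm norm_minus_commute)
  have "uniform_limit (cball x d) (\<lambda>N s. \<Sum>n<N. zeta_rem K s n) (\<lambda>s. \<Sum>n. zeta_rem K s n) sequentially"
    by (rule Weierstrass_m_test[of _ _ M]) (use M nle ge in auto)
  moreover have "cball x d \<subseteq> {s. Re s > 1 - real K}"
    using ge d by fastforce
  ultimately show "\<exists>d>0. cball x d \<subseteq> {s. Re s > 1 - real K} \<and>
     uniform_limit (cball x d) (\<lambda>N s. \<Sum>n<N. zeta_rem K s n) (\<lambda>s. \<Sum>n. zeta_rem K s n) sequentially"
    using d by blast
qed (auto intro!: holomorphic_intros)

section \<open>The Dirichlet series and its recursion\<close>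

definition dirichlet_zeta :: "complex \<Rightarrow> complex" where
  "dirichlet_zeta s = (\<Sum>n. 1 / of_nat (Suc n) powr s)"

lemma dirichlet_zeta_sums:
  assumes "Re s > 1"
  shows "(\<lambda>n. 1 / of_nat (Suc n) powr s) sums dirichlet_zeta s"
proof -
  have "summable (\<lambda>n. real (Suc n) powr (- Re s))"
    using assms by (subst summable_Suc_iff) (simp add: summable_real_powr_iff)
  hence "summable (\<lambda>n. norm (1 / of_nat (Suc n) powr s :: complex))"
    by (simp add: norm_inverse norm_powr_real_powr powr_minus divide_inverse del: of_nat_Suc)
  thus ?thesis
    unfolding dirichlet_zeta_def by (rule summable_sums[OF summable_norm_cancel])
qed

text \<open>Multiplying out the prefactor turns each remainder into a telescoping difference minus
  terms of the Dirichlet series at s + k - 1. The powers tend to 0 for Re s > 1, so the telescoping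
  sum is - 1.\<close>

lemma zeta_rem_sums:
  assumes s: "Re s > 1"
  shows "(\<lambda>n. zeta_rem K s n) sums
     (- 1 - (\<Sum>k=1..K. ((1 - s) gchoose k) * dirichlet_zeta (s + of_nat k - 1)))"
proof -
  define g where "g = (\<lambda>n. of_nat (Suc n) powr (1 - s) :: complex)"
  have eq: "zeta_rem K s n = (g (Suc n) - g n) -
     (\<Sum>k=1..K. ((1 - s) gchoose k) * (1 / of_nat (Suc n) powr (s + of_nat k - 1)))" for n
  proof -
    let ?x = "of_nat (Suc n) :: complex"
    have nz: "?x \<noteq> 0" by (simp del: of_nat_Suc)
    have "g n * (1 + of_real (1 / real (Suc n))) powr (1 - s) =
          (of_real (real (Suc n)) * of_real (1 + 1 / real (Suc n))) powr (1 - s)"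
      by (subst powr_times_real) (auto simp: g_def)
    also have "of_real (real (Suc n)) * of_real (1 + 1 / real (Suc n)) = (of_nat (Suc (Suc n)) :: complex)"
      using nz by (simp add: field_simps)
    finally have 1: "g n * (1 + of_real (1 / real (Suc n))) powr (1 - s) = g (Suc n)"
      by (simp add: g_def)
    have 2: "g n * of_real (1 / real (Suc n)) ^ k = 1 / ?x powr (s + of_nat k - 1)" for k
    proof -
      have "1 / ?x powr (s + of_nat k - 1) = ?x powr ((1 - s) - of_nat k)"
        by (simp add: powr_minus_divide[symmetric] algebra_simps del: of_nat_Suc)
      also have "\<dots> = g n / ?x ^ k"
        using nz by (simp add: powr_diff g_def powr_nat' del: of_nat_Suc)
      finally show ?thesis by (simp add: power_divide del: of_nat_Suc)
    qed
    \<comment> \<open>The term of degree 0 is split off: it equals \<open>g n\<close> and completes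
      the telescoping difference.\<close>
    have "{..<Suc K} = insert 0 {1..K}" by auto
    hence "zeta_rem K s n = g (Suc n) - g n * ((\<Sum>k\<in>insert 0 {1..K}. ((1 - s) gchoose k) * of_real (1 / real (Suc n)) ^ k))"
      unfolding zeta_rem_def right_diff_distrib 1[symmetric] by (simp add: g_def)
    also have "\<dots> = g (Suc n) - (g n + (\<Sum>k=1..K. ((1 - s) gchoose k) * (g n * of_real (1 / real (Suc n)) ^ k)))"
      by (subst sum.insert) (auto simp: ring_distribs sum_distrib_left mult_ac)
    finally show ?thesis unfolding 2 by simp
  qed
  have "(\<lambda>n. norm (g n)) \<longlonglongrightarrow> 0"
  proof -
    have "(\<lambda>n. real (Suc n) powr (1 - Re s)) \<longlonglongrightarrow> 0"
      using s by real_asymp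
    thus ?thesis by (simp add: g_def norm_powr_real_powr del: of_nat_Suc)
  qed
  hence "g \<longlonglongrightarrow> 0" by (rule tendsto_norm_zero_cancel)
  from telescope_sums[OF this] have "(\<lambda>n. g (Suc n) - g n) sums (- 1)" by (simp add: g_def)
  moreover have "(\<lambda>n. \<Sum>k=1..K. ((1 - s) gchoose k) * (1 / of_nat (Suc n) powr (s + of_nat k - 1))) sums
     (\<Sum>k=1..K. ((1 - s) gchoose k) * dirichlet_zeta (s + of_nat k - 1))"
    using s by (intro sums_sum sums_mult dirichlet_zeta_sums) auto
  ultimately show ?thesis unfolding eq by (rule sums_diff)
qed

text \<open>The term k = 1 is (1 - s) zeta(s) and is solved for. In the others the last factor of
  the binomial coefficient is, up to sign, s + k - 2, exactly the factor that cancels the pole of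
  zeta(s + k - 1).\<close>

lemma dirichlet_zeta_recursion:
  assumes s: "Re s > 1" and K: "K \<ge> 1"
  shows "(s - 1) * dirichlet_zeta s = 1 + (\<Sum>n. zeta_rem K s n) -
    (\<Sum>k=2..K. ((1 - s) gchoose (k - 1)) / of_nat k *
       ((s + of_nat k - 2) * dirichlet_zeta (s + of_nat k - 1)))"
proof -
  have "((1 - s) gchoose k) * dirichlet_zeta (s + of_nat k - 1) = - (((1 - s) gchoose (k - 1)) / of_nat k *
       ((s + of_nat k - 2) * dirichlet_zeta (s + of_nat k - 1)))" if "k \<in> {2..K}" for k
  proof -
    from that have "k \<noteq> 0" by simp
    then obtain j where j: "k = Suc j" by (auto simp: gr0_conv_Suc)
    have "((1 - s) gchoose k) = ((1 - s) gchoose j) * (1 - s - of_nat j) / of_nat (Suc j)"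
      unfolding j using gbinomial_mult_1[of "1 - s" j] by (simp add: field_simps del: of_nat_Suc)
    moreover have "1 - s - of_nat j = - (s + of_nat k - 2)" by (simp add: j)
    ultimately have "((1 - s) gchoose k) = - (((1 - s) gchoose (k - 1)) / of_nat k * (s + of_nat k - 2))"
      by (simp add: j del: of_nat_Suc minus_diff_eq)
    thus ?thesis by simp
  qed
  moreover have "{1..K} = insert 1 {2..K}" using K by auto
  ultimately have "(\<Sum>k=1..K. ((1 - s) gchoose k) * dirichlet_zeta (s + of_nat k - 1)) =
     (1 - s) * dirichlet_zeta s - (\<Sum>k=2..K. ((1 - s) gchoose (k - 1)) / of_nat k *
       ((s + of_nat k - 2) * dirichlet_zeta (s + of_nat k - 1)))"
    by (simp add: sum_negf)
  note X = this
  have *: "(s - 1) * Z = 1 + A - Y" if "X = (1 - s) * Z - Y" "A = - 1 - X" for A X Y Z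
    unfolding that by (simp add: algebra_simps)
  show ?thesis
    by (rule *[OF X zeta_rem_sums[OF s, of K, THEN sums_unique, symmetric]])
qed

text \<open>Each induction step gains a strip of width 1: the recursion evaluates the known
  extension only at s + k - 1 with k >= 2, at least one unit further to the right.\<close>

lemma dirichlet_zeta_continuation_halfplane:
  "\<exists>F. F holomorphic_on {s. Re s > - real K} \<and> (\<forall>s. Re s > 1 \<longrightarrow> F s = (s - 1) * dirichlet_zeta s)"
proof (induction K)
  case 0
  have "(\<lambda>s. 1 + (\<Sum>n. zeta_rem 1 s n)) holomorphic_on {s. Re s > - real 0}"
    using holomorphic_suminf_zeta_rem[of 1] by (intro holomorphic_intros) simp_all
  moreover have "\<forall>s. Re s > 1 \<longrightarrow> 1 + (\<Sum>n. zeta_rem 1 s n) = (s - 1) * dirichlet_zeta s"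
    using dirichlet_zeta_recursion[of _ 1] by simp
  ultimately show ?case by blast
next
  case (Suc K)
  then obtain F where F: "F holomorphic_on {s. Re s > - real K}"
     "\<And>s. Re s > 1 \<Longrightarrow> F s = (s - 1) * dirichlet_zeta s" by blast
  \<comment> \<open>With \<open>K + 2\<close> the series of remainders is holomorphic for Re s > 1 -
    (K + 2), which is the new half-plane.\<close>
  define G where "G = (\<lambda>s. 1 + (\<Sum>n. zeta_rem (K + 2) s n) -
    (\<Sum>k=2..K+2. ((1 - s) gchoose (k - 1)) / of_nat k * F (s + of_nat k - 1)))"
  have 1: "(\<lambda>s. \<Sum>n. zeta_rem (K + 2) s n) holomorphic_on {s. Re s > - real (Suc K)}"
    using holomorphic_suminf_zeta_rem[of "K + 2"] by simp
  have 2: "(\<lambda>s. F (s + of_nat k - 1)) holomorphic_on {s. Re s > - real (Suc K)}" if "k \<in> {2..K+2}" for k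
    by (rule holomorphic_on_compose_gen[OF _ F(1), unfolded o_def])
       (use that in \<open>auto intro!: holomorphic_intros\<close>)
  have 3: "(\<lambda>s::complex. (1 - s) gchoose k) holomorphic_on A" for k A
    unfolding gbinomial_prod_rev by (intro holomorphic_intros) auto
  have "G holomorphic_on {s. Re s > - real (Suc K)}"
    unfolding G_def by (intro holomorphic_intros 1 2 3) auto
  moreover have "G s = (s - 1) * dirichlet_zeta s" if "Re s > 1" for s
  proof -
    have "F (s + of_nat k - 1) = (s + of_nat k - 2) * dirichlet_zeta (s + of_nat k - 1)"
      if "k \<in> {2..K+2}" for k
      using that \<open>Re s > 1\<close> by (subst F(2)) auto
    hence "(\<Sum>k=2..K+2. ((1 - s) gchoose (k - 1)) / of_nat k * F (s + of_nat k - 1)) =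
           (\<Sum>k=2..K+2. ((1 - s) gchoose (k - 1)) / of_nat k *
              ((s + of_nat k - 2) * dirichlet_zeta (s + of_nat k - 1)))"
      by (intro sum.cong refl) (simp only:)
    thus ?thesis
      using dirichlet_zeta_recursion[OF that, of "K + 2"] unfolding G_def by simp
  qed
  ultimately show ?case by blast
qed

text \<open>The extensions to the half-planes agree on overlaps by the identity theorem and are
  glued by choosing for each \<open>s\<close> a half-plane that contains it.\<close>

lemma dirichlet_zeta_continuation:
  "\<exists>F. F holomorphic_on UNIV \<and> (\<forall>s. Re s > 1 \<longrightarrow> F s = (s - 1) * dirichlet_zeta s)"
proof -
  have "\<exists>F. \<forall>K. F K holomorphic_on {s. Re s > - real K} \<and> (\<forall>s. Re s > 1 \<longrightarrow> F K s = (s - 1) * dirichlet_zeta s)"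
    using dirichlet_zeta_continuation_halfplane by (intro choice) blast
  then obtain F where F: "\<And>K. F K holomorphic_on {s. Re s > - real K}"
     "\<And>K s. Re s > 1 \<Longrightarrow> F K s = (s - 1) * dirichlet_zeta s" by blast
  have eq: "F i s = F j s" if "Re s > - real i" "Re s > - real j" for i j s
  proof (rule analytic_continuation_open[where f = "F i" and g = "F j" and s = "{s. Re s > 1}"
         and s' = "{s. Re s > - real i} \<inter> {s. Re s > - real j}"])
    show "connected ({s. Re s > - real i} \<inter> {s. Re s > - real j})"
      by (intro convex_connected convex_Int convex_halfspace_Re_gt)
    have "2 \<in> {s. Re s > 1}" by simp
    thus "{s. Re s > 1} \<noteq> {}" by blast
  qed (use that F(2) in \<open>auto intro!: open_Int open_halfspace_Re_gt
         holomorphic_on_subset[OF F(1)]\<close>)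
  define N where "N = (\<lambda>s. nat \<lceil>- Re s\<rceil> + 1)"
  have N: "Re s > - real (N s)" for s
    unfolding N_def by linarith
  define G where "G = (\<lambda>s. F (N s) s)"
  have "G holomorphic_on UNIV"
  proof (subst holomorphic_on_open)
    show "\<forall>x\<in>UNIV. \<exists>f'. (G has_field_derivative f') (at x)"
    proof
      fix z
      have "(F (N z) has_field_derivative deriv (F (N z)) z) (at z)"
        using N by (intro holomorphic_derivI[OF F(1)] open_halfspace_Re_gt) auto
      moreover have "eventually (\<lambda>s. s \<in> {s. Re s > - real (N z)}) (nhds z)"
        using N by (intro eventually_nhds_in_open open_halfspace_Re_gt) auto
      \<comment> \<open>The index \<open>N s\<close> may jump near \<open>z\<close>; agreement on
        overlaps replaces it by the fixed index \<open>N z\<close>.\<close>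
      hence "eventually (\<lambda>s. F (N z) s = G s) (nhds z)"
        by eventually_elim (auto simp only: G_def mem_Collect_eq intro!: eq N)
      ultimately have "(G has_field_derivative deriv (F (N z)) z) (at z)"
        by (subst (asm) DERIV_cong_ev[OF refl _ refl])
      thus "\<exists>f'. (G has_field_derivative f') (at z)" ..
    qed
  qed auto
  thus ?thesis using F(2) by (intro exI[of _ G]) (auto simp: G_def)
qed

section \<open>Special values of the continuation and identification with
  \<open>riemann_zeta\<close>\<close>

lemma one_plus_inverse_nat_nonzero: "1 + 1 / of_nat (Suc n) \<noteq> (0 :: complex)"
proof -
  have "(1 + 1 / of_nat (Suc n) :: complex) = of_real (1 + 1 / real (Suc n))" by simp
  moreover have "1 + 1 / real (Suc n) > 0" by (intro add_pos_pos) auto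
  ultimately show ?thesis by (metis of_real_eq_0_iff less_irrefl)
qed

text \<open>At s = 1 the exponent 1 - s is 0, and the Taylor polynomial is exact.\<close>

lemma zeta_rem_1_1: "zeta_rem 1 1 n = 0"
  using one_plus_inverse_nat_nonzero[of n] by (simp add: zeta_rem_def del: of_nat_Suc)

text \<open>At s = 0 the exponent is 1: the expanded function is itself linear and the quadratic
  coefficient vanishes.\<close>

lemma zeta_rem_2_0: "zeta_rem 2 0 n = 0"
proof -
  have "(1 :: complex) gchoose Suc (Suc 0) = 0"
    by (simp add: gbinomial_prod_rev)
  thus ?thesis
    using one_plus_inverse_nat_nonzero[of n]
    by (simp add: zeta_rem_def numeral_2_eq_2 del: of_nat_Suc)
qed

text \<open>The entire function F(s) = (s - 1) zeta(s) yields both a witness for the definite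
  description and, through the continued recursion, the value at 0.\<close>

lemma riemann_zeta_properties:
  shows riemann_zeta_sums: "Re s > 1 \<Longrightarrow> (\<lambda>n. 1 / of_nat (Suc n) powr s) sums riemann_zeta s"
    and riemann_zeta_0: "riemann_zeta 0 = - 1 / 2"
proof -
  obtain F where F: "F holomorphic_on UNIV" "\<And>s. Re s > 1 \<Longrightarrow> F s = (s - 1) * dirichlet_zeta s"
    using dirichlet_zeta_continuation by blast
  have comp: "(\<lambda>s. F (s + c)) holomorphic_on A" for c A
    by (rule holomorphic_on_compose_gen[OF _ F(1), unfolded o_def]) (auto intro!: holomorphic_intros)
  have gbin: "(\<lambda>s::complex. (1 - s) gchoose k) holomorphic_on A" for k A
    unfolding gbinomial_prod_rev by (intro holomorphic_intros) auto
  \<comment> \<open>Both sides are holomorphic for Re s > 1 - K and agree for Re s > 1, so the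
    recursion persists where the Dirichlet series diverges.\<close>
  have rec: "F s = 1 + (\<Sum>n. zeta_rem K s n) -
    (\<Sum>k=2..K. ((1 - s) gchoose (k - 1)) / of_nat k * F (s + (of_nat k - 1)))" (is "_ = ?G s")
    if "K \<ge> 1" "Re s > 1 - real K" for K s
  proof (rule analytic_continuation_open[where f = F and g = ?G and s = "{s. Re s > 1}"
         and s' = "{s. Re s > 1 - real K}"])
    show "?G holomorphic_on {s. Re s > 1 - real K}"
      by (intro holomorphic_intros holomorphic_suminf_zeta_rem gbin comp) auto
    have "2 \<in> {s. Re s > 1}" by simp
    thus "{s. Re s > 1} \<noteq> {}" by blast
    show "connected {s. Re s > 1 - real K}"
      by (intro convex_connected convex_halfspace_Re_gt)
    fix s assume "s \<in> {s. Re s > 1}"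
    hence s: "Re s > 1" by simp
    have "F (s + (of_nat k - 1)) = (s + of_nat k - 2) * dirichlet_zeta (s + of_nat k - 1)"
      if "k \<in> {2..K}" for k
      using that s by (subst F(2)) (auto simp: algebra_simps)
    hence "(\<Sum>k=2..K. ((1 - s) gchoose (k - 1)) / of_nat k * F (s + (of_nat k - 1))) =
           (\<Sum>k=2..K. ((1 - s) gchoose (k - 1)) / of_nat k *
              ((s + of_nat k - 2) * dirichlet_zeta (s + of_nat k - 1)))"
      by (intro sum.cong refl) (simp only:)
    thus "F s = ?G s"
      using dirichlet_zeta_recursion[OF s \<open>K \<ge> 1\<close>] F(2)[OF s] by (simp only:)
  qed (use that in \<open>auto intro!: open_halfspace_Re_gt holomorphic_on_subset[OF F(1)]\<close>)
  have F1: "F 1 = 1" using rec[of 1 1] by (simp add: zeta_rem_1_1[simplified])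
  \<comment> \<open>For K = 2 and s = 0 only k = 2 contributes, giving F(0) = 1 - F(1) / 2.\<close>
  have F0: "F 0 = 1 / 2" using rec[of 2 0] F1 by (simp add: zeta_rem_2_0)
  define f where "f = (\<lambda>s. if s = 1 then 0 else F s / (s - 1))"
  let ?P = "\<lambda>f. f holomorphic_on (- {1}) \<and>
     (\<forall>s. Re s > 1 \<longrightarrow> (\<lambda>n. 1 / of_nat (Suc n) powr s) sums f s) \<and> f 1 = 0"
  have f: "?P f"
  proof (intro conjI allI impI)
    have "(\<lambda>s. F s / (s - 1)) holomorphic_on (- {1})"
      by (intro holomorphic_intros holomorphic_on_subset[OF F(1)]) auto
    thus "f holomorphic_on (- {1})"
      by (rule holomorphic_transform) (auto simp: f_def)
    fix s assume s: "Re s > 1"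
    hence "s \<noteq> 1" by auto
    hence "f s = dirichlet_zeta s" using F(2)[OF s] by (simp add: f_def)
    thus "(\<lambda>n. 1 / of_nat (Suc n) powr s) sums f s"
      using dirichlet_zeta_sums[OF s] by simp
  qed (simp add: f_def)
  \<comment> \<open>Uniqueness off the pole is the identity theorem on the connected punctured
    plane; at 1 both functions have the prescribed value 0.\<close>
  have "riemann_zeta = f"
    unfolding riemann_zeta_def
  proof (rule the_equality)
    fix g assume g: "?P g"
    have "g s = f s" if "s \<noteq> 1" for s
    proof (rule analytic_continuation_open[where f = g and g = f and s = "{s. Re s > 1}" and s' = "- {1}"])
      show "connected (- {1 :: complex})"
        by (rule connected_punctured_universe) simp
      have "2 \<in> {s. Re s > 1}" by simp
      thus "{s. Re s > 1} \<noteq> {}" by blast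
      fix z assume "z \<in> {s. Re s > 1}"
      thus "g z = f z" using f g by (auto intro: sums_unique2)
    qed (use f g that in \<open>auto intro!: open_halfspace_Re_gt\<close>)
    thus "g = f" using f g by (metis ext)
  qed (fact f)
  moreover have "f 0 = - 1 / 2" using F0 by (simp add: f_def)
  ultimately show "Re s > 1 \<Longrightarrow> (\<lambda>n. 1 / of_nat (Suc n) powr s) sums riemann_zeta s"
       "riemann_zeta 0 = - 1 / 2"
    using f by simp_all
qed

section \<open>Power series of even powers of the reciprocal sinc function\<close>

text \<open>The function is the difference quotient at 0 of sin(pi z) / pi, with its removable
  singularity filled by the derivative 1.\<close>

lemma holomorphic_sinc_pi: "sinc_pi holomorphic_on A"
proof -
  define f where "f = (\<lambda>z::complex. sin (of_real pi * z) / of_real pi)"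
  have "(f has_field_derivative 1) (at 0)"
    unfolding f_def by (auto intro!: derivative_eq_intros)
  hence "deriv f 0 = 1" by (rule DERIV_imp_deriv)
  moreover have "(\<lambda>z. if z = 0 then deriv f 0 else (f z - f 0) / (z - 0)) holomorphic_on UNIV"
    by (rule pole_lemma_open) (auto simp: f_def intro!: holomorphic_intros)
  moreover have "sinc_pi = (\<lambda>z. if z = 0 then 1 else (f z - f 0) / (z - 0))"
    by (rule ext) (simp add: f_def sinc_pi_def)
  ultimately have "sinc_pi holomorphic_on UNIV" by (simp only:)
  thus ?thesis by (rule holomorphic_on_subset) auto
qed

lemma sin_pi_eq_0_iff: "sin (of_real pi * z) = 0 \<longleftrightarrow> (z :: complex) \<in> \<int>"
proof -
  have "sin (of_real pi * z) = 0 \<longleftrightarrow> (\<exists>n::int. of_real pi * z = of_real pi * of_int n)"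
    unfolding sin_eq_0 by (simp add: mult.commute)
  also have "\<dots> \<longleftrightarrow> z \<in> \<int>"
    by (auto elim!: Ints_cases)
  finally show ?thesis .
qed

lemma nonint_unit_disc: "norm (z :: complex) < 1 \<Longrightarrow> z \<noteq> 0 \<Longrightarrow> z \<notin> \<int>"
proof
  assume z: "norm z < 1" "z \<noteq> 0" "z \<in> \<int>"
  then obtain n where n: "z = of_int n" by (elim Ints_cases)
  hence "\<bar>real_of_int n\<bar> < 1" using z(1) by simp
  hence "n = 0" by linarith
  thus False using n z(2) by simp
qed

lemma sinc_pi_nonzero: "norm z < 1 \<Longrightarrow> sinc_pi z \<noteq> 0"
  by (auto simp: sinc_pi_def sin_pi_eq_0_iff nonint_unit_disc)

text \<open>Averaging the Taylor series at z and - z cancels the odd terms and, by evenness, keeps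
  the sum.\<close>

lemma even_power_series:
  assumes hol: "g holomorphic_on ball 0 1" and even: "\<And>z. g (- z) = g z"
  shows "\<exists>a. \<forall>z. norm z < 1 \<longrightarrow> (\<lambda>j. a j * z ^ (2 * j)) sums (g z :: complex)"
proof -
  define b where "b = (\<lambda>n. (deriv ^^ n) g 0 / fact n)"
  have b: "(\<lambda>n. b n * z ^ n) sums g z" if "norm z < 1" for z
    using holomorphic_power_series[OF hol, of z] that by (simp add: b_def)
  have "(\<lambda>j. b (2 * j) * z ^ (2 * j)) sums g z" if z: "norm z < 1" for z
  proof -
    define c where "c = (\<lambda>n. (b n * z ^ n + b n * (- z) ^ n) / 2)"
    have "c sums ((g z + g (- z)) / 2)"
      unfolding c_def using z by (intro sums_divide sums_add b) auto
    hence "c sums g z" by (simp add: even)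
    moreover have "c n = 0" if "n \<notin> range (\<lambda>j. 2 * j)" for n
    proof -
      have "odd n" using that by auto
      thus ?thesis by (simp add: c_def)
    qed
    ultimately have "(\<lambda>j. c (2 * j)) sums g z"
      by (subst sums_mono_reindex) (auto simp: strict_mono_def)
    thus ?thesis by (simp add: c_def)
  qed
  thus ?thesis by (intro exI[of _ "\<lambda>j. b (2 * j)"] allI impI)
qed

text \<open>Substituting a square root of w for z makes the difference an ordinary power series in w
  with sum 0.\<close>

lemma even_power_series_unique:
  assumes "\<And>z. norm z < 1 \<Longrightarrow> (\<lambda>j. a j * z ^ (2 * j)) sums (g z :: complex)"
      and "\<And>z. norm z < 1 \<Longrightarrow> (\<lambda>j. b j * z ^ (2 * j)) sums g z"
  shows "a = b"
proof (rule ccontr)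
  define d where "d = (\<lambda>j. a j - b j)"
  have d: "(\<lambda>j. d j * (w - 0) ^ j) sums 0" if "norm (w - 0) < 1" for w
  proof -
    have "norm (csqrt w) < 1"
      using that by simp
    hence "(\<lambda>j. a j * csqrt w ^ (2 * j) - b j * csqrt w ^ (2 * j)) sums (g (csqrt w) - g (csqrt w))"
      by (intro sums_diff assms)
    moreover have "csqrt w ^ (2 * j) = w ^ j" for j
      by (subst power_mult) simp
    ultimately show ?thesis by (simp add: d_def left_diff_distrib)
  qed
  have "d 0 = 0" using d[of 0] by simp
  assume "a \<noteq> b"
  then obtain m where "d m \<noteq> 0" by (auto simp: d_def)
  with \<open>d 0 = 0\<close> have "m > 0" by (auto intro: gr0I)
  obtain s where "0 < s" "\<And>z::complex. z \<in> cball 0 s - {0} \<Longrightarrow> (0::complex) \<noteq> 0"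
    \<comment> \<open>A nonzero coefficient of positive index would make the sum, which is
      constantly 0, nonzero on a punctured disc.\<close>
    by (rule powser_0_nonzero[of 1 0 d "\<lambda>_. 0" m]) (use d \<open>d m \<noteq> 0\<close> \<open>m > 0\<close> in auto)
  from this(2)[of "of_real s"] \<open>0 < s\<close> show False by simp
qed

text \<open>For an even integer \<open>s\<close> the complex power is an integer power, so no branch
  enters; existence and uniqueness of the even expansion then resolve the definite
  description.\<close>

lemma sinc_coeff_sums:
  assumes s: "s = 2 * of_nat m" and z: "norm z < 1"
  shows "(\<lambda>j. sinc_coeff j s * z ^ (2 * j)) sums (inverse (sinc_pi z) ^ (2 * m))"
proof -
  define g where "g = (\<lambda>z. inverse (sinc_pi z) ^ (2 * m))"
  have eq: "sinc_pi z powr (- s) = g z" if "norm z < 1" for z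
    using powr_nat'[of "sinc_pi z" "2 * m"] sinc_pi_nonzero[OF that]
    by (simp add: powr_minus s g_def power_inverse)
  have "g holomorphic_on ball 0 1"
    unfolding g_def using sinc_pi_nonzero by (intro holomorphic_intros holomorphic_sinc_pi) auto
  moreover have "g (- z) = g z" for z
    by (simp add: g_def sinc_pi_def)
  ultimately obtain a where a: "\<And>z. norm z < 1 \<Longrightarrow> (\<lambda>j. a j * z ^ (2 * j)) sums g z"
    using even_power_series by blast
  have "(THE a. \<forall>z. norm z < 1 \<longrightarrow> (\<lambda>j. a j * z ^ (2 * j)) sums (sinc_pi z powr (- s))) = a"
  proof (rule the_equality)
    fix b assume "\<forall>z. norm z < 1 \<longrightarrow> (\<lambda>j. b j * z ^ (2 * j)) sums (sinc_pi z powr (- s))"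
    hence "(\<lambda>j. b j * z ^ (2 * j)) sums g z" if "norm z < 1" for z
      using that eq[OF that] by metis
    from even_power_series_unique[OF this a] show "b = a" .
  qed (simp add: eq a)
  hence "sinc_coeff j s = a j" for j
    by (simp add: sinc_coeff_def)
  thus ?thesis using a[OF z] by (simp add: g_def)
qed

section \<open>Lattice sums\<close>

lemma has_sum_nonzero_ints:
  fixes f :: "int \<Rightarrow> 'a :: real_normed_vector"
  assumes "((\<lambda>n. f (int (Suc n))) has_sum S) UNIV" "\<And>j. f (- j) = f j"
  shows "(f has_sum (S + S)) (- {0})"
proof -
  have "(f has_sum S) (range (\<lambda>n. int (Suc n)))"
    using assms(1) by (subst has_sum_reindex) (auto simp: o_def inj_on_def)
  moreover have "(f has_sum S) (range (\<lambda>n. - int (Suc n)))"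
    using assms(1) by (subst has_sum_reindex) (simp_all add: o_def inj_on_def assms(2) del: of_nat_Suc)
  ultimately have "(f has_sum (S + S)) (range (\<lambda>n. int (Suc n)) \<union> range (\<lambda>n. - int (Suc n)))"
    by (rule has_sum_Un_disjoint) auto
  also have "range (\<lambda>n. int (Suc n)) \<union> range (\<lambda>n. - int (Suc n)) = - {0}"
  proof -
    have "j \<in> range (\<lambda>n. int (Suc n)) \<union> range (\<lambda>n. - int (Suc n))" if "j \<noteq> 0" for j
    proof (cases "j > 0")
      case True
      hence "j = int (Suc (nat (j - 1)))" by simp
      thus ?thesis by blast
    next
      case False
      hence "j = - int (Suc (nat (- j - 1)))" using that by simp
      thus ?thesis by blast
    qed
    thus ?thesis by auto
  qed
  finally show ?thesis .
qed

lemma summable_on_inverse_square_ints: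
  "(\<lambda>j. 1 / real_of_int j ^ 2) summable_on (- {0})"
proof -
  have "summable (\<lambda>n. inverse (real (Suc n) ^ 2))"
    by (subst summable_Suc_iff) (rule inverse_power_summable, simp)
  hence "summable (\<lambda>n. 1 / real_of_int (int (Suc n)) ^ 2)"
    by (simp add: inverse_eq_divide del: of_nat_Suc)
  then obtain S where "(\<lambda>n. 1 / real_of_int (int (Suc n)) ^ 2) sums S"
    by (auto simp: summable_def)
  hence "((\<lambda>n. 1 / real_of_int (int (Suc n)) ^ 2) has_sum S) UNIV"
    by (intro norm_summable_imp_has_sum) (auto simp: sums_iff simp del: of_nat_Suc of_int_of_nat_eq)
  hence "((\<lambda>j. 1 / real_of_int j ^ 2) has_sum (S + S)) (- {0})"
    by (rule has_sum_nonzero_ints) simp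
  thus ?thesis by (auto simp: summable_on_def)
qed

text \<open>Eisenstein's trigonometric series. The index set is a parameter because
  \<open>UNIV\<close> gives the periodic function and \<open>- {0}\<close> its part regular at
  0.\<close>

definition lattice_sum :: "int set \<Rightarrow> nat \<Rightarrow> complex \<Rightarrow> complex" where
  "lattice_sum A p z = (\<Sum>\<^sub>\<infinity>j\<in>A. 1 / (z + of_int j) ^ (2 * p))"

text \<open>Since |j| >= 1, the distance |z + j| is at least |j| - 3/4 >= |j| / 4, whence 16 ^ p.
  The bound 3/4 gives an open strip that contains a closed period strip and no integer other than
  0.\<close>

lemma lattice_term_bound:
  assumes "\<bar>Re z\<bar> < 3 / 4" "j \<noteq> 0" "p > 0"
  shows "norm (1 / (z + of_int j) ^ (2 * p)) \<le> 16 ^ p * (1 / real_of_int j ^ 2)"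
proof -
  have j: "\<bar>real_of_int j\<bar> \<ge> 1" using assms(2) by linarith
  have "\<bar>real_of_int j\<bar> / 4 \<le> \<bar>Re (z + of_int j)\<bar>"
    using assms(1) j by (simp add: abs_if split: if_splits)
  also have "\<dots> \<le> norm (z + of_int j)" by (rule abs_Re_le_cmod)
  finally have "(\<bar>real_of_int j\<bar> / 4) ^ (2 * p) \<le> norm (z + of_int j) ^ (2 * p)"
    by (intro power_mono) auto
  moreover have "(\<bar>real_of_int j\<bar> / 4) ^ (2 * p) = \<bar>real_of_int j\<bar> ^ (2 * p) / 16 ^ p"
    by (simp add: power_divide power_mult)
  moreover have "\<bar>real_of_int j\<bar> ^ 2 \<le> \<bar>real_of_int j\<bar> ^ (2 * p)"
    using j assms(3) by (intro power_increasing) auto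
  ultimately have "\<bar>real_of_int j\<bar> ^ 2 / 16 ^ p \<le> norm (z + of_int j) ^ (2 * p)"
    by (smt (verit, best) divide_right_mono zero_le_power)
  hence "inverse (norm (z + of_int j) ^ (2 * p)) \<le> inverse (\<bar>real_of_int j\<bar> ^ 2 / 16 ^ p)"
    using j by (intro le_imp_inverse_le) auto
  thus ?thesis by (simp add: norm_divide norm_power field_simps)
qed

lemma lattice_bound_summable: "(\<lambda>j. 16 ^ p * (1 / real_of_int j ^ 2)) summable_on (- {0})"
  by (intro summable_on_cmult_right summable_on_inverse_square_ints)

lemma lattice_terms_summable:
  assumes "\<bar>Re z\<bar> < 3 / 4" "p > 0"
  shows "(\<lambda>j. 1 / (z + of_int j) ^ (2 * p)) summable_on (- {0})"
  by (rule abs_summable_summable, rule Infinite_Sum.abs_summable_on_comparison_test'[OF lattice_bound_summable[of p]])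
     (use lattice_term_bound[OF assms(1) _ assms(2)] in auto)

lemma lattice_sum_bounded:
  assumes "p > 0"
  shows "\<exists>B. \<forall>z. \<bar>Re z\<bar> < 3 / 4 \<longrightarrow> norm (lattice_sum (- {0}) p z) \<le> B"
proof -
  have "norm (lattice_sum (- {0}) p z) \<le> (\<Sum>\<^sub>\<infinity>j\<in>-{0}. 16 ^ p * (1 / real_of_int j ^ 2))"
    if "\<bar>Re z\<bar> < 3 / 4" for z
    unfolding lattice_sum_def
    by (rule norm_infsum_le[OF has_sum_infsum[OF lattice_terms_summable[OF that assms]]
          has_sum_infsum[OF lattice_bound_summable[of p]]])
       (use lattice_term_bound[OF that _ assms] in auto)
  thus ?thesis by blast
qed

lemma lattice_sum_uniform_limit:
  assumes "p > 0" "S \<subseteq> {z. \<bar>Re z\<bar> < 3 / 4}"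
  shows "uniform_limit S (\<lambda>X z. \<Sum>j\<in>X. 1 / (z + of_int j) ^ (2 * p)) (lattice_sum (- {0}) p)
           (finite_subsets_at_top (- {0}))"
  unfolding lattice_sum_def
  by (rule Weierstrass_m_test_general[where M = "\<lambda>j. 16 ^ p * (1 / real_of_int j ^ 2)"])
     (use lattice_term_bound[OF _ _ assms(1)] lattice_bound_summable assms(2) in auto)

lemma open_strip: "open {z. \<bar>Re z\<bar> < c}"
  by (intro open_Collect_less continuous_intros)

lemma add_int_nonzero_in_strip:
  assumes "\<bar>Re z\<bar> < 3 / 4" "j \<noteq> 0"
  shows "z + of_int j \<noteq> 0"
proof
  assume "z + of_int j = 0"
  hence "Re z + of_int j = 0" by (metis Re_complex_of_real plus_complex.sel(1) of_real_of_int_eq zero_complex.sel(1))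
  moreover have "\<bar>real_of_int j\<bar> \<ge> 1" using assms(2) by linarith
  ultimately show False using assms(1) by linarith
qed

lemma lattice_sum_holomorphic:
  assumes "p > 0"
  shows "lattice_sum (- {0}) p holomorphic_on {z. \<bar>Re z\<bar> < 3 / 4}"
proof (subst holomorphic_on_open[OF open_strip], intro ballI)
  fix z assume "z \<in> {z. \<bar>Re z\<bar> < 3 / 4}"
  then obtain r where r: "r > 0" "cball z r \<subseteq> {z. \<bar>Re z\<bar> < 3 / 4}"
    using open_contains_cball[of "{z. \<bar>Re z\<bar> < 3 / 4}"] open_strip by blast
  have hol: "(\<lambda>z. \<Sum>j\<in>X. 1 / (z + of_int j) ^ (2 * p)) holomorphic_on cball z r"
    if "finite X" "X \<subseteq> - {0}" for X
    using that r(2) add_int_nonzero_in_strip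
    by (intro holomorphic_intros) (auto simp: subset_iff)
  have "\<forall>\<^sub>F X in finite_subsets_at_top (- {0}).
      continuous_on (cball z r) (\<lambda>z. \<Sum>j\<in>X. 1 / (z + of_int j) ^ (2 * p)) \<and>
      (\<lambda>z. \<Sum>j\<in>X. 1 / (z + of_int j) ^ (2 * p)) holomorphic_on ball z r"
    using hol by (intro eventually_finite_subsets_at_top_weakI)
      (auto intro: holomorphic_on_imp_continuous_on holomorphic_on_subset[OF _ ball_subset_cball])
  then obtain "lattice_sum (- {0}) p holomorphic_on ball z r"
    by (rule holomorphic_uniform_limit[OF _ lattice_sum_uniform_limit[OF assms r(2)]]) auto
  thus "\<exists>f'. (lattice_sum (- {0}) p has_field_derivative f') (at z)"
    using r(1) by (auto simp: holomorphic_on_open)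
qed

lemma tendsto_inverse_power_imaginary:
  assumes "p > 0"
  shows "((\<lambda>y. 1 / (\<i> * of_real y + c) ^ p) \<longlongrightarrow> 0) at_top"
proof -
  have "filterlim (\<lambda>y. \<i> * of_real y + c) at_infinity at_top"
    unfolding filterlim_at_infinity_conv_norm_at_top
  proof (rule filterlim_at_top_mono)
    show "filterlim (\<lambda>y. y + Im c) at_top at_top" by real_asymp
    show "\<forall>\<^sub>F y in at_top. y + Im c \<le> norm (\<i> * of_real y + c)"
    proof (rule always_eventually, rule allI)
      fix y
      show "y + Im c \<le> norm (\<i> * of_real y + c)"
        using abs_Im_le_cmod[of "\<i> * of_real y + c"] by simp
    qed
  qed
  hence "((\<lambda>y. inverse (\<i> * of_real y + c) ^ p) \<longlongrightarrow> 0 ^ p) at_top"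
    by (intro tendsto_power filterlim_compose[OF tendsto_inverse_0])
  thus ?thesis using assms by (simp add: power_inverse inverse_eq_divide power_divide zero_power)
qed

text \<open>Each term tends to 0, and convergence uniform on the strip permits exchanging the two
  limits.\<close>

lemma lattice_sum_tendsto_0:
  assumes "p > 0"
  shows "((\<lambda>y. lattice_sum (- {0}) p (\<i> * of_real y)) \<longlongrightarrow> 0) at_top"
proof (rule swap_uniform_limit')
  show "uniform_limit UNIV (\<lambda>X y. \<Sum>j\<in>X. 1 / (\<i> * of_real y + of_int j) ^ (2 * p))
          (\<lambda>y. lattice_sum (- {0}) p (\<i> * of_real y)) (finite_subsets_at_top (- {0}))"
    by (rule uniform_limit_compose'[OF lattice_sum_uniform_limit[OF assms order_refl]]) auto
  show "\<forall>\<^sub>F X in finite_subsets_at_top (- {0}).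
    ((\<lambda>y. \<Sum>j\<in>X. 1 / (\<i> * of_real y + of_int j) ^ (2 * p)) \<longlongrightarrow> 0) at_top"
    using assms by (intro always_eventually allI tendsto_null_sum tendsto_inverse_power_imaginary) auto
qed auto

lemma lattice_sum_shift: "lattice_sum UNIV p (z + of_int n) = lattice_sum UNIV p z"
  unfolding lattice_sum_def
  by (rule infsum_reindex_bij_witness[where i = "\<lambda>j. j - n" and j = "\<lambda>j. j + n"]) (auto simp: add_ac)

text \<open>This also holds at z = 0, where the singular term is 0 on both sides by the convention
  for division by 0.\<close>

lemma lattice_sum_split:
  assumes "\<bar>Re z\<bar> < 3 / 4" "p > 0"
  shows "lattice_sum UNIV p z = 1 / z ^ (2 * p) + lattice_sum (- {0}) p z"
proof -
  have "lattice_sum (insert 0 (- {0})) p z = 1 / z ^ (2 * p) + lattice_sum (- {0}) p z"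
    unfolding lattice_sum_def using lattice_terms_summable[OF assms]
    by (subst infsum_insert) auto
  moreover have "insert 0 (- {0 :: int}) = UNIV" by auto
  ultimately show ?thesis by (simp only:)
qed

section \<open>Partial fractions of even cosecant powers\<close>

text \<open>What remains of $(\pi / \sin \pi z)^{2m}$ after removing its principal part at $0$.\<close>

definition csc_regular :: "nat \<Rightarrow> (nat \<Rightarrow> complex) \<Rightarrow> complex \<Rightarrow> complex" where
  "csc_regular m a z = (if z = 0 then a m
     else (of_real pi / sin (of_real pi * z)) ^ (2 * m) - (\<Sum>n<m. a n / z ^ (2 * (m - n))))"

text \<open>Dividing the given series by z ^ (2 * m) makes its first \<open>m\<close> terms the
  principal part; the rest is the shifted series, with constant term \<open>a m\<close>.\<close>

lemma csc_regular_sums: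
  assumes a: "(\<lambda>j. a j * z ^ (2 * j)) sums (inverse (sinc_pi z) ^ (2 * m))"
  shows "(\<lambda>j. a (j + m) * z ^ (2 * j)) sums csc_regular m a z"
proof (cases "z = 0")
  case True
  have "(\<lambda>j. a (j + m) * 0 ^ j) sums a (0 + m)" by (rule powser_sums_zero)
  thus ?thesis using True by (simp add: csc_regular_def power_mult del: power2_eq_square)
next
  case False
  have "(\<lambda>j. a (j + m) * z ^ (2 * (j + m)) / z ^ (2 * m)) sums
     ((inverse (sinc_pi z) ^ (2 * m) - (\<Sum>n<m. a n * z ^ (2 * n))) / z ^ (2 * m))"
    by (intro sums_divide sums_split_initial_segment a)
  moreover have "a (j + m) * z ^ (2 * (j + m)) / z ^ (2 * m) = a (j + m) * z ^ (2 * j)" for j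
    using False by (simp add: distrib_left power_add)
  moreover have "a n * z ^ (2 * n) / z ^ (2 * m) = a n / z ^ (2 * (m - n))" if "n < m" for n
  proof -
    have "2 * m = 2 * n + 2 * (m - n)" using that by simp
    hence "z ^ (2 * m) = z ^ (2 * n) * z ^ (2 * (m - n))" by (metis power_add)
    thus ?thesis using False by simp
  qed
  moreover have "inverse (sinc_pi z) ^ (2 * m) / z ^ (2 * m) =
      (of_real pi / sin (of_real pi * z)) ^ (2 * m)"
    using False by (simp add: sinc_pi_def flip: power_divide)
  ultimately show ?thesis
    using False by (simp add: csc_regular_def diff_divide_distrib sum_divide_distrib)
qed

text \<open>On the unit disc the function is a power series in the square of z; on the strip without
  0 the sine has no zero.\<close>

lemma csc_regular_holomorphic:
  assumes a: "\<And>z. norm z < 1 \<Longrightarrow> (\<lambda>j. a j * z ^ (2 * j)) sums (inverse (sinc_pi z) ^ (2 * m))"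
  shows "csc_regular m a holomorphic_on {z. \<bar>Re z\<bar> < 3 / 4}"
proof -
  define B where "B = (\<lambda>w. csc_regular m a (csqrt w))"
  have sq: "(\<lambda>j. a (j + m) * (z ^ 2) ^ j) sums csc_regular m a z" if "norm z < 1" for z
    using csc_regular_sums[OF a[OF that]] by (simp add: power_mult)
  have "B holomorphic_on ball 0 1"
  proof (rule power_series_holomorphic)
    fix w :: complex assume "w \<in> ball 0 1"
    thus "(\<lambda>j. a (j + m) * (w - 0) ^ j) sums B w"
      using sq[of "csqrt w"] by (simp add: B_def)
  qed
  hence "(\<lambda>z. B (z ^ 2)) holomorphic_on ball 0 1"
    by (rule holomorphic_on_compose_gen[rotated, unfolded o_def])
       (auto intro!: holomorphic_intros simp: norm_power abs_square_less_1)
  moreover have "B (z ^ 2) = csc_regular m a z" if "z \<in> ball 0 1" for z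
  proof -
    have "norm (csqrt (z ^ 2)) < 1" using that by (simp add: norm_power abs_square_less_1)
    \<comment> \<open>The square root of z ^ 2 may be - z, but the series depends on the square
      only.\<close>
    from sq[OF this] sq[of z] that show ?thesis
      by (auto simp: B_def intro: sums_unique2)
  qed
  ultimately have 1: "csc_regular m a holomorphic_on ball 0 1"
    by (rule holomorphic_transform)
  have nz: "sin (of_real pi * z) \<noteq> 0" if "z \<in> {z. \<bar>Re z\<bar> < 3 / 4} - {0}" for z
  proof
    assume "sin (of_real pi * z) = 0"
    then obtain n where n: "z = of_int n" by (auto simp: sin_pi_eq_0_iff elim!: Ints_cases)
    with that add_int_nonzero_in_strip[of z "- n"] show False by auto
  qed
  have "(\<lambda>z. (of_real pi / sin (of_real pi * z)) ^ (2 * m) - (\<Sum>n<m. a n / z ^ (2 * (m - n))))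
          holomorphic_on ({z. \<bar>Re z\<bar> < 3 / 4} - {0})"
    using nz by (intro holomorphic_intros) auto
  hence 2: "csc_regular m a holomorphic_on ({z. \<bar>Re z\<bar> < 3 / 4} - {0})"
    by (rule holomorphic_transform) (auto simp: csc_regular_def)
  have "csc_regular m a holomorphic_on (ball 0 1 \<union> ({z. \<bar>Re z\<bar> < 3 / 4} - {0}))"
    by (intro holomorphic_on_Un 1 2 open_Diff open_strip) auto
  thus ?thesis by (rule holomorphic_on_subset) auto
qed

text \<open>The exponentials of i w and - i w have moduli exp(- Im w) and exp(Im w), which differ by
  at least exp |Im w| - 1 >= |Im w|. Linear growth suffices for both boundedness and decay of the
  cosecant powers.\<close>

lemma norm_sin_ge: "\<bar>Im w\<bar> / 2 \<le> norm (sin w)"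
proof -
  have *: "exp \<bar>y\<bar> - 1 \<le> \<bar>exp (- y) - exp y\<bar>" for y :: real
    by (cases "y \<ge> 0") (auto simp: abs_if)
  have "\<bar>Im w\<bar> \<le> exp \<bar>Im w\<bar> - 1"
    using exp_ge_add_one_self[of "\<bar>Im w\<bar>"] by linarith
  also have "\<dots> \<le> \<bar>norm (exp (\<i> * w)) - norm (exp (- (\<i> * w)))\<bar>"
    using *[of "Im w"] by simp
  also have "\<dots> \<le> norm (exp (\<i> * w) - exp (- (\<i> * w)))"
    by (rule norm_triangle_ineq3)
  finally show ?thesis
    by (simp add: sin_exp_eq' norm_mult norm_divide norm_minus_commute)
qed

lemma csc_power_bound:
  assumes "Im z \<noteq> 0"
  shows "norm ((of_real pi / sin (of_real pi * z)) ^ (2 * m)) \<le> (2 / \<bar>Im z\<bar>) ^ (2 * m)"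
proof -
  have "pi * \<bar>Im z\<bar> / 2 \<le> norm (sin (of_real pi * z))"
    using norm_sin_ge[of "of_real pi * z"] by (simp add: abs_mult)
  moreover have "pi * \<bar>Im z\<bar> / 2 > 0" using assms by simp
  ultimately have "pi / norm (sin (of_real pi * z)) \<le> pi / (pi * \<bar>Im z\<bar> / 2)"
    by (intro divide_left_mono mult_pos_pos) auto
  also have "\<dots> = 2 / \<bar>Im z\<bar>" by simp
  finally show ?thesis
    unfolding norm_power by (intro power_mono) (auto simp: norm_divide)
qed

lemma csc_regular_bound:
  assumes "\<bar>Im z\<bar> \<ge> 1"
  shows "norm (csc_regular m a z) \<le> 2 ^ (2 * m) + (\<Sum>n<m. norm (a n))"
proof -
  have z: "z \<noteq> 0" "norm z \<ge> 1" using assms abs_Im_le_cmod[of z] by auto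
  have "norm ((of_real pi / sin (of_real pi * z)) ^ (2 * m)) \<le> (2 / \<bar>Im z\<bar>) ^ (2 * m)"
    using assms by (intro csc_power_bound) auto
  also have "\<dots> \<le> 2 ^ (2 * m)"
    using assms by (intro power_mono) (auto simp: field_simps)
  finally have 1: "norm ((of_real pi / sin (of_real pi * z)) ^ (2 * m)) \<le> 2 ^ (2 * m)" .
  have "norm (a n / z ^ (2 * (m - n))) \<le> norm (a n)" for n
    using z by (auto simp: norm_divide norm_power divide_le_eq_1 intro!: divide_left_mono[of 1, simplified] one_le_power)
  hence 2: "norm (\<Sum>n<m. a n / z ^ (2 * (m - n))) \<le> (\<Sum>n<m. norm (a n))"
    by (intro sum_norm_le) auto
  show ?thesis
    using norm_triangle_ineq4[of "(of_real pi / sin (of_real pi * z)) ^ (2 * m)"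
        "\<Sum>n<m. a n / z ^ (2 * (m - n))"] 1 2 z
    by (simp add: csc_regular_def)
qed

lemma csc_regular_tendsto_0:
  assumes "m > 0"
  shows "((\<lambda>y. csc_regular m a (\<i> * of_real y)) \<longlongrightarrow> 0) at_top"
proof -
  have "((\<lambda>y. (of_real pi / sin (of_real pi * (\<i> * of_real y))) ^ (2 * m)) \<longlongrightarrow> (0::complex)) at_top"
  proof (rule Lim_null_comparison)
    show "\<forall>\<^sub>F y in at_top. norm ((of_real pi / sin (of_real pi * (\<i> * of_real y))) ^ (2 * m) :: complex)
            \<le> (2 / y) ^ (2 * m)"
      using eventually_gt_at_top[of 0]
    proof eventually_elim
      case (elim y)
      thus ?case using csc_power_bound[of "\<i> * of_real y" m] by simp
    qed
    have "((\<lambda>y::real. 2 / y) \<longlongrightarrow> 0) at_top" by real_asymp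
    from tendsto_power[OF this, of "2 * m"]
    show "((\<lambda>y::real. (2 / y) ^ (2 * m)) \<longlongrightarrow> 0) at_top"
      using assms by (simp add: zero_power)
  qed
  moreover have "((\<lambda>y. a n / (\<i> * of_real y) ^ (2 * (m - n))) \<longlongrightarrow> 0) at_top" if "n < m" for n
    using tendsto_mult_right_zero[OF tendsto_inverse_power_imaginary[of "2 * (m - n)" 0], of "a n"] that
    by simp
  hence "((\<lambda>y. \<Sum>n<m. a n / (\<i> * of_real y) ^ (2 * (m - n))) \<longlongrightarrow> 0) at_top"
    by (intro tendsto_null_sum) auto
  ultimately have "((\<lambda>y. (of_real pi / sin (of_real pi * (\<i> * of_real y))) ^ (2 * m) -
      (\<Sum>n<m. a n / (\<i> * of_real y) ^ (2 * (m - n)))) \<longlongrightarrow> 0 - 0) at_top"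
    by (rule tendsto_diff)
  moreover have "\<forall>\<^sub>F y in at_top. (of_real pi / sin (of_real pi * (\<i> * of_real y))) ^ (2 * m) -
      (\<Sum>n<m. a n / (\<i> * of_real y) ^ (2 * (m - n))) = csc_regular m a (\<i> * of_real y)"
    using eventually_gt_at_top[of 0]
    by eventually_elim (auto simp: csc_regular_def)
  ultimately show ?thesis
    using tendsto_cong by fastforce
qed

text \<open>A shift by \<open>n\<close> multiplies the sine by a sign, which the even power
  removes.\<close>

lemma sin_shift_int_power: "sin (of_real pi * (z + of_int n)) ^ (2 * m) = sin (of_real pi * z :: complex) ^ (2 * m)"
proof -
  have s: "sin (of_real pi * of_int n :: complex) = 0"
    by (subst sin_pi_eq_0_iff) simp
  hence c: "cos (of_real pi * of_int n :: complex) ^ 2 = 1"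
    using sin_cos_squared_add[of "of_real pi * of_int n :: complex"] by simp
  have "sin (of_real pi * (z + of_int n)) = sin (of_real pi * z) * cos (of_real pi * of_int n)"
    by (simp add: distrib_left sin_add s)
  thus ?thesis by (simp add: power_mult power_mult_distrib c)
qed

text \<open>A single Liouville argument gives both conclusions: the expansion off the integers, and
  the comparison of constant terms at 0.\<close>

lemma csc_partial_fractions:
  assumes m: "m > 0"
    and a: "\<And>z. norm z < 1 \<Longrightarrow> (\<lambda>j. a j * z ^ (2 * j)) sums (inverse (sinc_pi z) ^ (2 * m))"
  shows csc_power_eq_lattice_sums:
      "z \<notin> \<int> \<Longrightarrow> (of_real pi / sin (of_real pi * z)) ^ (2 * m) =
         (\<Sum>n<m. a n * lattice_sum UNIV (m - n) z)"
    and csc_constant_term: "a m = (\<Sum>n<m. a n * lattice_sum (- {0}) (m - n) 0)"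
proof -
  define S where "S = {z. \<bar>Re z\<bar> < 3 / 4}"
  \<comment> \<open>\<open>G\<close> is visibly holomorphic, but only on the strip; \<open>H\<close>
    is visibly periodic. They agree on the strip, so each inherits the other's property where
    needed.\<close>
  define G where "G = (\<lambda>z. csc_regular m a z - (\<Sum>n<m. a n * lattice_sum (- {0}) (m - n) z))"
  define H where "H = (\<lambda>z. if z \<in> \<int> then G 0 else
     (of_real pi / sin (of_real pi * z)) ^ (2 * m) - (\<Sum>n<m. a n * lattice_sum UNIV (m - n) z))"
  have H_G: "H z = G z" if z: "z \<in> S" for z
  proof (cases "z \<in> \<int>")
    case True
    then obtain n where n: "z = of_int n" by (elim Ints_cases)
    have "z = 0" using add_int_nonzero_in_strip[of z "- n"] z n by (auto simp: S_def)
    thus ?thesis by (simp add: H_def)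
  next
    case False
    hence "z \<noteq> 0" by auto
    have "lattice_sum UNIV (m - n) z = 1 / z ^ (2 * (m - n)) + lattice_sum (- {0}) (m - n) z"
      if "n \<in> {..<m}" for n
      using z that by (intro lattice_sum_split) (auto simp: S_def)
    hence "(\<Sum>n<m. a n * lattice_sum UNIV (m - n) z) =
        (\<Sum>n<m. a n / z ^ (2 * (m - n)) + a n * lattice_sum (- {0}) (m - n) z)"
      by (intro sum.cong refl) (simp add: distrib_left)
    thus ?thesis using False \<open>z \<noteq> 0\<close>
      by (simp add: H_def G_def csc_regular_def sum.distrib)
  qed
  have H_shift: "H (z + of_int n) = H z" for z n
    by (simp add: H_def lattice_sum_shift power_divide sin_shift_int_power)
  have G_hol: "G holomorphic_on S"
    unfolding G_def S_def
    by (intro holomorphic_intros csc_regular_holomorphic lattice_sum_holomorphic a) auto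
  \<comment> \<open>Rounding the real part moves every point into the closed period strip inside
    \<open>S\<close>.\<close>
  have near: "\<exists>n. \<bar>Re (z + of_int n)\<bar> \<le> 1 / 2" for z
    using of_int_round_abs_le[of "Re z"] by (intro exI[of _ "- round (Re z)"]) (simp add: abs_minus_commute)
  have H_hol: "H holomorphic_on UNIV"
  proof (subst holomorphic_on_open)
    show "\<forall>z\<in>UNIV. \<exists>f'. (H has_field_derivative f') (at z)"
    proof
      fix z
      obtain n where "\<bar>Re (z + of_int n)\<bar> \<le> 1 / 2" using near by blast
      hence z: "z + of_int n \<in> S" by (simp add: S_def)
      have S: "open S" unfolding S_def by (rule open_strip)
      have "(G has_field_derivative deriv G (z + of_int n)) (at (z + of_int n))"
        by (rule holomorphic_derivI[OF G_hol S z])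
      moreover have "\<forall>\<^sub>F w in nhds (z + of_int n). H w = G w"
        using eventually_nhds_in_open[OF S z] by eventually_elim (rule H_G)
      ultimately have "(H has_field_derivative deriv G (z + of_int n)) (at (z + of_int n))"
        by (subst DERIV_cong_ev[OF refl _ refl])
      hence "((\<lambda>w. H (w + of_int n)) has_field_derivative deriv G (z + of_int n)) (at z)"
        by (subst (asm) DERIV_shift)
      thus "\<exists>f'. (H has_field_derivative f') (at z)" unfolding H_shift ..
    qed
  qed auto
  have "bounded (range H)"
  proof -
    \<comment> \<open>Compactness bounds \<open>G\<close> on the part of the period strip with |Im
      z| <= 1; the explicit estimates handle the rest.\<close>
    have "compact (cbox (- Complex (1/2) 1) (Complex (1/2) 1))" by (rule compact_cbox)
    moreover have sub: "cbox (- Complex (1/2) 1) (Complex (1/2) 1) \<subseteq> S"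
      by (auto simp: S_def in_cbox_complex_iff)
    ultimately have "bounded (G ` cbox (- Complex (1/2) 1) (Complex (1/2) 1))"
      by (intro compact_imp_bounded compact_continuous_image holomorphic_on_imp_continuous_on
                holomorphic_on_subset[OF G_hol])
    then obtain B1 where B1: "\<And>z. z \<in> cbox (- Complex (1/2) 1) (Complex (1/2) 1) \<Longrightarrow> norm (G z) \<le> B1"
      by (auto simp: bounded_iff)
    have "\<forall>n\<in>{..<m}. \<exists>B. \<forall>z. \<bar>Re z\<bar> < 3 / 4 \<longrightarrow> norm (lattice_sum (- {0}) (m - n) z) \<le> B"
      by (intro ballI lattice_sum_bounded) auto
    then obtain B where B: "\<And>n z. n < m \<Longrightarrow> \<bar>Re z\<bar> < 3 / 4 \<Longrightarrow>
        norm (lattice_sum (- {0}) (m - n) z) \<le> B n"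
      unfolding bchoice_iff by auto
    define B2 where "B2 = 2 ^ (2 * m) + (\<Sum>n<m. norm (a n)) + (\<Sum>n<m. norm (a n) * B n)"
    have "norm (H z) \<le> max B1 B2" for z
    proof -
      obtain n where n: "\<bar>Re (z + of_int n)\<bar> \<le> 1 / 2" using near by blast
      define w where "w = z + of_int n"
      have w: "\<bar>Re w\<bar> \<le> 1 / 2" using n by (simp add: w_def)
      have "norm (G w) \<le> max B1 B2"
      proof (cases "\<bar>Im w\<bar> \<le> 1")
        case True
        hence "w \<in> cbox (- Complex (1/2) 1) (Complex (1/2) 1)"
          using w by (auto simp: in_cbox_complex_iff abs_le_iff)
        thus ?thesis using B1 by (simp add: max.coboundedI1)
      next
        case False
        have "norm (\<Sum>n<m. a n * lattice_sum (- {0}) (m - n) w) \<le> (\<Sum>n<m. norm (a n) * B n)"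
          using w by (intro sum_norm_le) (auto simp: norm_mult intro!: mult_left_mono B)
        moreover have "norm (csc_regular m a w) \<le> 2 ^ (2 * m) + (\<Sum>n<m. norm (a n))"
          using False by (intro csc_regular_bound) auto
        ultimately have "norm (G w) \<le> B2"
          unfolding G_def B2_def by (intro order_trans[OF norm_triangle_ineq4]) simp
        thus ?thesis by simp
      qed
      moreover have "H z = G w"
        using H_G[of w] H_shift[of z n] w by (simp add: w_def S_def)
      ultimately show ?thesis by simp
    qed
    thus ?thesis by (auto simp: bounded_iff)
  qed
  from Liouville_theorem[OF H_hol this] obtain c where c: "\<And>z. H z = c"
    by (auto simp: constant_on_def)
  \<comment> \<open>The constant is found along the imaginary axis, which lies in the strip.\<close>
  have "((\<lambda>y. G (\<i> * of_real y)) \<longlongrightarrow> 0 - 0) at_top"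
    unfolding G_def
    by (intro tendsto_diff csc_regular_tendsto_0 m tendsto_null_sum tendsto_mult_right_zero
              lattice_sum_tendsto_0) auto
  moreover have "G (\<i> * of_real y) = c" for y
    using H_G[of "\<i> * of_real y"] c by (simp add: S_def)
  ultimately have "((\<lambda>y::real. c) \<longlongrightarrow> 0) at_top" by simp
  hence "c = 0" by (simp add: tendsto_const_iff)
  show "(of_real pi / sin (of_real pi * z)) ^ (2 * m) = (\<Sum>n<m. a n * lattice_sum UNIV (m - n) z)"
    if "z \<notin> \<int>"
    using c[of z] that by (simp add: \<open>c = 0\<close> H_def)
  show "a m = (\<Sum>n<m. a n * lattice_sum (- {0}) (m - n) 0)"
    using c[of 0] by (simp add: \<open>c = 0\<close> H_def G_def csc_regular_def)
qed

section \<open>Zeta values as lattice sums and summation over k / N\<close>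

lemma has_sum_nonzero_ints_zeta:
  assumes "p > 0"
  shows "((\<lambda>j. 1 / of_int j ^ (2 * p)) has_sum 2 * riemann_zeta (2 * of_nat p)) (- {0})"
proof -
  have *: "1 / of_nat (Suc n) powr (2 * of_nat p) = (1 / of_int (int (Suc n)) ^ (2 * p) :: complex)" for n
    using powr_nat'[of "of_nat (Suc n)" "2 * p"] by (simp del: of_nat_Suc)
  have "(\<lambda>n. 1 / of_int (int (Suc n)) ^ (2 * p)) sums riemann_zeta (2 * of_nat p)"
    using riemann_zeta_sums[of "2 * of_nat p"] assms unfolding * by simp
  moreover have "summable (\<lambda>n. norm (1 / of_int (int (Suc n)) ^ (2 * p) :: complex))"
  proof -
    have "summable (\<lambda>n. inverse (real (Suc n) ^ (2 * p)))"
      by (subst summable_Suc_iff) (rule inverse_power_summable, use assms in simp)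
    thus ?thesis
      by (simp add: norm_divide norm_power inverse_eq_divide del: of_nat_Suc)
  qed
  ultimately have "((\<lambda>n. 1 / of_int (int (Suc n)) ^ (2 * p)) has_sum riemann_zeta (2 * of_nat p)) UNIV"
    by (intro norm_summable_imp_has_sum)
  from has_sum_nonzero_ints[OF this] show ?thesis by simp
qed

lemma lattice_sum_0:
  "p > 0 \<Longrightarrow> lattice_sum (- {0}) p 0 = 2 * riemann_zeta (2 * of_nat p)"
  using infsumI[OF has_sum_nonzero_ints_zeta[of p]] by (simp add: lattice_sum_def)

text \<open>Scaled by N ^ (2 * p), the lattice sum at k / N becomes a sum over the residue class of
  k modulo N. These classes and the nonzero multiples of N partition the nonzero integers.\<close>

lemma sum_lattice_sum_fractions:
  assumes p: "p > 0" and N: "N > 0"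
  shows "(\<Sum>k=1..N-1. lattice_sum UNIV p (of_nat k / of_nat N)) =
           2 * riemann_zeta (2 * of_nat p) * (of_nat N ^ (2 * p) - 1)"
proof -
  define f :: "int \<Rightarrow> complex" where "f = (\<lambda>j. 1 / of_int j ^ (2 * p))"
  define Z where "Z = 2 * riemann_zeta (2 * of_nat p)"
  define R where "R = (\<lambda>k. range (\<lambda>j. int k + int N * j))"
  have f: "(f has_sum Z) (- {0})"
    unfolding f_def Z_def by (rule has_sum_nonzero_ints_zeta[OF p])
  have inj: "inj_on (\<lambda>j. int k + int N * j) A" for k A using N by (auto simp: inj_on_def)
  have R_mod: "x mod int N = int k" if "k \<in> {1..N-1}" "x \<in> R k" for k x
    using that N by (auto simp: R_def)
  have R_sub: "R k \<subseteq> - {0}" if "k \<in> {1..N-1}" for k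
    using R_mod[OF that, of 0] that by auto
  have R_sum: "(f has_sum (lattice_sum UNIV p (of_nat k / of_nat N) / of_nat N ^ (2 * p))) (R k)"
    if "k \<in> {1..N-1}" for k
  proof -
    have "f summable_on R k"
      by (rule summable_on_subset_banach[OF has_sum_imp_summable[OF f] R_sub[OF that]])
    hence "(f has_sum infsum f (R k)) (R k)" by (rule has_sum_infsum)
    moreover have "lattice_sum UNIV p (of_nat k / of_nat N) = of_nat N ^ (2 * p) * infsum f (R k)"
    proof -
      have "infsum f (R k) = (\<Sum>\<^sub>\<infinity>j. f (int k + int N * j))"
        unfolding R_def by (subst infsum_reindex[OF inj]) (simp add: o_def)
      also have "\<dots> = (\<Sum>\<^sub>\<infinity>j. (1 / of_nat N ^ (2 * p)) * (1 / (of_nat k / of_nat N + of_int j) ^ (2 * p)))"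
      proof (intro infsum_cong)
        fix j :: int
        have "(of_int (int k + int N * j) :: complex) = of_nat N * (of_nat k / of_nat N + of_int j)"
          using N by (simp add: field_simps)
        thus "f (int k + int N * j) = (1 / of_nat N ^ (2 * p)) * (1 / (of_nat k / of_nat N + of_int j) ^ (2 * p))"
          unfolding f_def by (simp add: power_mult_distrib del: of_int_add)
      qed
      also have "\<dots> = (1 / of_nat N ^ (2 * p)) * lattice_sum UNIV p (of_nat k / of_nat N)"
        unfolding lattice_sum_def by (rule infsum_cmult_right')
      finally show ?thesis using N by simp
    qed
    ultimately show ?thesis using N by simp
  qed
  \<comment> \<open>The multiples of N contribute the full sum scaled down, which is the origin of
    the - 1 in the result.\<close>
  have "(f has_sum (Z / of_nat N ^ (2 * p))) ((\<lambda>j. int N * j) ` (- {0}))"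
  proof (subst has_sum_reindex)
    show "inj_on (\<lambda>j. int N * j) (- {0})" using inj[of 0] by simp
    have "f \<circ> (\<lambda>j. int N * j) = (\<lambda>j. f j / of_nat N ^ (2 * p))"
      by (auto simp: f_def fun_eq_iff power_mult_distrib)
    thus "((f \<circ> (\<lambda>j. int N * j)) has_sum (Z / of_nat N ^ (2 * p))) (- {0})"
      using has_sum_divide_const[OF f] by simp
  qed
  moreover have "(f has_sum (\<Sum>k=1..N-1. lattice_sum UNIV p (of_nat k / of_nat N) / of_nat N ^ (2 * p)))
       (\<Union>k\<in>{1..N-1}. R k)"
  proof (rule sum_has_sum)
    fix k l assume "k \<in> {1..N-1}" "l \<in> {1..N-1}" "k \<noteq> l"
    thus "R k \<inter> R l = {}" using R_mod[of k] R_mod[of l] by force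
  qed (use R_sum in auto)
  moreover have "((\<lambda>j. int N * j) ` (- {0})) \<inter> (\<Union>k\<in>{1..N-1}. R k) = {}"
    using R_mod by force
  ultimately have "(f has_sum (Z / of_nat N ^ (2 * p) +
       (\<Sum>k=1..N-1. lattice_sum UNIV p (of_nat k / of_nat N) / of_nat N ^ (2 * p))))
       ((\<lambda>j. int N * j) ` (- {0}) \<union> (\<Union>k\<in>{1..N-1}. R k))"
    by (rule has_sum_Un_disjoint)
  also have "(\<lambda>j. int N * j) ` (- {0}) \<union> (\<Union>k\<in>{1..N-1}. R k) = - {0}"
  proof
    show "(\<lambda>j. int N * j) ` (- {0}) \<union> (\<Union>k\<in>{1..N-1}. R k) \<subseteq> - {0}"
      using R_sub N by auto
    show "- {0} \<subseteq> (\<lambda>j. int N * j) ` (- {0}) \<union> (\<Union>k\<in>{1..N-1}. R k)"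
    proof
      fix x :: int assume x: "x \<in> - {0}"
      define k where "k = nat (x mod int N)"
      have k: "int k = x mod int N" using N by (simp add: k_def)
      have eq: "x = int k + int N * (x div int N)" by (simp add: k)
      show "x \<in> (\<lambda>j. int N * j) ` (- {0}) \<union> (\<Union>k\<in>{1..N-1}. R k)"
      proof (cases "k = 0")
        case True
        hence "x = int N * (x div int N)" using eq by simp
        moreover from this have "x div int N \<noteq> 0" using x by auto
        ultimately show ?thesis by blast
      next
        case False
        have "int k < int N" unfolding k using N by simp
        hence "k \<in> {1..N-1}" using False by auto
        moreover have "x \<in> R k" unfolding R_def using eq by (rule range_eqI)
        ultimately show ?thesis by blast
      qed
    qed
  qed
  finally have "Z = Z / of_nat N ^ (2 * p) +
       (\<Sum>k=1..N-1. lattice_sum UNIV p (of_nat k / of_nat N)) / of_nat N ^ (2 * p)"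
    using f by (auto simp: sum_divide_distrib intro: has_sum_unique)
  hence "Z * of_nat N ^ (2 * p) = Z + (\<Sum>k=1..N-1. lattice_sum UNIV p (of_nat k / of_nat N))"
    using N by (simp add: field_simps)
  thus ?thesis by (simp add: Z_def algebra_simps)
qed

section \<open>Evaluation of the Riesz sum at even integers\<close>

theorem mainTheorem3:
  fixes m N :: nat and s :: complex
  assumes "m > 0" and "s = 2 * of_nat m" and "N \<ge> 2"
  shows "riesz_sum s N =
    (\<Sum>n = 0..m. sinc_coeff n s *
       (2 * riemann_zeta (s - 2 * of_nat n) / (2 * of_real pi) powr s) *
       of_nat N powr (1 + s - 2 * of_nat n))"
proof -
  define a where "a = (\<lambda>n. sinc_coeff n s)"
  define Z where "Z = (\<lambda>p. 2 * riemann_zeta (2 * of_nat p))"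
  have N: "N > 0" using assms(3) by simp
  have a: "(\<lambda>j. a j * z ^ (2 * j)) sums (inverse (sinc_pi z) ^ (2 * m))" if "norm z < 1" for z
    unfolding a_def by (rule sinc_coeff_sums[OF assms(2) that])
  have neg_powr: "x powr (- s) = inverse x ^ (2 * m)" for x :: complex
    using powr_nat'[of x "2 * m"] assms(1,2) by (simp add: powr_minus power_inverse)
  have pi_powr: "(2 * of_real pi) powr s = (2 * of_real pi :: complex) ^ (2 * m)"
    using powr_nat'[of "2 * of_real pi" "2 * m"] assms(1,2) by simp
  \<comment> \<open>For n <= m the natural subtraction \<open>m - n\<close> does not truncate, so
    the exponent is a positive integer.\<close>
  have N_powr: "of_nat N powr (1 + s - 2 * of_nat n) = (of_nat N * of_nat N ^ (2 * (m - n)) :: complex)"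
    if "n \<le> m" for n
  proof -
    have "1 + s - 2 * of_nat n = of_nat (Suc (2 * (m - n)))"
      using that assms(2) by (simp add: of_nat_diff algebra_simps)
    thus ?thesis using powr_nat'[of "of_nat N" "Suc (2 * (m - n))"] by (simp only:) simp
  qed
  have zeta: "2 * riemann_zeta (s - 2 * of_nat n) = Z (m - n)" if "n \<le> m" for n
    using that assms(2) by (simp add: Z_def of_nat_diff algebra_simps)
  have "(\<Sum>n<m. a n * lattice_sum (- {0}) (m - n) 0) = (\<Sum>n<m. a n * Z (m - n))"
    by (intro sum.cong refl) (simp add: lattice_sum_0 Z_def)
  hence am: "a m = (\<Sum>n<m. a n * Z (m - n))"
    using csc_constant_term[OF assms(1) a] by (simp only:)
  have "(\<Sum>k=1..N-1. (of_real pi * inverse (complex_of_real (sin (pi * real k / real N)))) ^ (2 * m)) =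
        (\<Sum>k=1..N-1. \<Sum>n<m. a n * lattice_sum UNIV (m - n) (of_nat k / of_nat N))"
  proof (intro sum.cong refl)
    fix k assume k: "k \<in> {1..N-1}"
    have "norm (of_nat k / of_nat N :: complex) < 1" "(of_nat k / of_nat N :: complex) \<noteq> 0"
      using k N by (auto simp: norm_divide)
    hence "(of_nat k / of_nat N :: complex) \<notin> \<int>" by (rule nonint_unit_disc)
    from csc_power_eq_lattice_sums[OF assms(1) a this]
    show "(of_real pi * inverse (complex_of_real (sin (pi * real k / real N)))) ^ (2 * m) =
        (\<Sum>n<m. a n * lattice_sum UNIV (m - n) (of_nat k / of_nat N))"
      by (simp add: divide_inverse sin_of_real[symmetric] mult.assoc)
  qed
  also have "\<dots> = (\<Sum>n<m. a n * (Z (m - n) * (of_nat N ^ (2 * (m - n)) - 1)))"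
    by (subst sum.swap) (intro sum.cong refl,
        simp add: sum_distrib_left[symmetric] sum_lattice_sum_fractions[OF _ N, simplified] Z_def)
  \<comment> \<open>By \<open>am\<close> the contributions of - 1 add up to -
    \<open>a m\<close>.\<close>
  also have "\<dots> = (\<Sum>n<m. a n * Z (m - n) * of_nat N ^ (2 * (m - n))) - a m"
    by (simp add: am algebra_simps sum_subtractf)
  \<comment> \<open>Since Z 0 = 2 zeta(0) = - 1, the summand - \<open>a m\<close> is the term n =
    m.\<close>
  also have "\<dots> = (\<Sum>n=0..m. a n * Z (m - n) * of_nat N ^ (2 * (m - n)))"
  proof -
    have "{0..m} = insert m {..<m}" by auto
    thus ?thesis by (simp add: Z_def riemann_zeta_0)
  qed
  finally have main: "(\<Sum>k=1..N-1. inverse (complex_of_real (sin (pi * real k / real N))) ^ (2 * m)) =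
      (\<Sum>n=0..m. a n * Z (m - n) * of_nat N ^ (2 * (m - n))) / of_real pi ^ (2 * m)"
    unfolding power_mult_distrib sum_distrib_left[symmetric]
    by (subst eq_divide_eq) (simp add: mult.commute)
  \<comment> \<open>The prefactor 2 powr (- s) and the division by pi ^ (2 * m) combine into the
    power of 2 pi.\<close>
  have "riesz_sum s N = (\<Sum>n=0..m. a n * (Z (m - n) / (2 * of_real pi) ^ (2 * m)) *
      (of_nat N * of_nat N ^ (2 * (m - n))))"
    unfolding riesz_sum_def neg_powr main sum_divide_distrib sum_distrib_left
    by (intro sum.cong refl) (simp add: power_mult_distrib power_inverse field_simps)
  also have "\<dots> = (\<Sum>n = 0..m. sinc_coeff n s *
       (2 * riemann_zeta (s - 2 * of_nat n) / (2 * of_real pi) powr s) *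
       of_nat N powr (1 + s - 2 * of_nat n))"
    unfolding pi_powr by (intro sum.cong refl) (simp add: zeta N_powr a_def)
  finally show ?thesis .
qed

end
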